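(* Let $F$ be a fractal of unity generated by the planar IFS $\mathcal{T}=\{T_1,\dots,T_n\}$. Consider the procedure that examines $L=1,2,3,\dots$ successively and stops at the first $L=L_*$ for which $\mathrm{EFoc}_L(F)\neq\varnothing$ and $$H(\mathrm{EFoc}_L(F))\subset\mathrm{Conv}(\mathrm{EFoc}_L(F)).$$ Then the procedure terminates, with $L_*\le 2|\nu(\mathcal{A}_{fin})|$, and $\mathrm{Ext}(F)=\mathrm{Ext}(\mathrm{EFoc}_{L_*}(F))$.
   Context: IFS: $T_k(z)=p_k+\varphi_k(z-p_k)$ on $\mathbb{C}$, $k\in\mathcal{N}=\{1,\dots,n\}$, with $p_k\in\mathbb{C}$, $\varphi_k=\lambda_k e^{\vartheta_k i}$, $\lambda_k\in(0,1)$, rotation angle $\vartheta_k\in(-\pi,\pi]$. The Hutchinson operator is $H(S)=\bigcup_{k}T_k(S)$ for $S\subset\mathbb{C}$, and the IFS fractal $F$ is the unique nonempty compact set with $H(F)=F$. It is a fractal of unity if $\vartheta_k/(2\pi)\in\mathbb{Q}$ for all $k$. $\mathcal{A}_{fin}$ is the set of finite words (addresses) over $\mathcal{N}$, including the empty word, written $0$, of length $|0|=0$. For finite $a$, $T_a=T_{a(1)}\circ\dots\circ T_{a(|a|)}$, $T_0=\mathrm{Id}$; $ab$ is concatenation; $b<a$ means $b$ is a prefix of $a$ ($b=a$ and $b=0$ allowed). For $x\in\mathcal{A}_{fin}\setminus\{0\}$, $p_x$ is the unique fixed point of $T_x$. The value of a finite address is $\nu(a)=\vartheta_{a(1)}+\dots+\vartheta_{a(|a|)}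 \bmod 2\pi\in[0,2\pi)$, $\nu(0)=0$, and $\nu(\mathcal{A}_{fin})=\{\nu(a):a\in\mathcal{A}_{fin}\}$, a finite set for a fractal of unity. A finite address $a$ is blowable if there are $b,x\in\mathcal{A}_{fin}$ with $bx<a$, $\nu(x)=0$, $x\ne0$; taking the shortest such $bx$, its blow-up is $\mathrm{blo}(a)=T_b(p_x)$. For $L\in\mathbb{N}$, $L\geq 1$, $\mathrm{EFoc}_L(F)=\{\mathrm{blo}(a): |a|=L,\ a \text{ blowable}\}$. $\mathrm{Conv}$ is the convex hull, and $\mathrm{Ext}(S)$ for compact $S\subset\mathbb{C}$ is the set of extreme points (vertices) of $\mathrm{Conv}(S)$. *)

theory Defs
  imports "HOL-Analysis.Analysis" "HOL-Library.Real_Mod" "HOL-Library.Sublist"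
begin

text \<open>
  The \<open>k\<close>-th map, for \<open>k \<in> {1..num I}\<close>, has centre \<open>center I k\<close>, contraction ratio \<open>ratio I k\<close> and
  rotation angle \<open>angle I k\<close>; values at other indices are irrelevant.
\<close>

record planar_ifs =
  num :: nat
  center :: "nat \<Rightarrow> complex"
  ratio :: "nat \<Rightarrow> real"
  angle :: "nat \<Rightarrow> real"

definition is_planar_ifs :: "planar_ifs \<Rightarrow> bool" where
  "is_planar_ifs I \<longleftrightarrow>
     num I \<ge> 1 \<and>
     (\<forall>k\<in>{1..num I}. 0 < ratio I k \<and> ratio I k < 1 \<and> - pi < angle I k \<and> angle I k \<le> pi)"

definition of_unity :: "planar_ifs \<Rightarrow> bool" where
  "of_unity I \<longleftrightarrow> (\<forall>k\<in>{1..num I}. angle I k / (2 * pi) \<in> \<rat>)"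

definition ifs_map :: "planar_ifs \<Rightarrow> nat \<Rightarrow> complex \<Rightarrow> complex" where
  "ifs_map I k z = center I k + rcis (ratio I k) (angle I k) * (z - center I k)"

definition hutchinson :: "planar_ifs \<Rightarrow> complex set \<Rightarrow> complex set" where
  "hutchinson I S = (\<Union>k\<in>{1..num I}. ifs_map I k ` S)"

definition ifs_fractal :: "planar_ifs \<Rightarrow> complex set" where
  "ifs_fractal I = (THE F. F \<noteq> {} \<and> compact F \<and> hutchinson I F = F)"

definition addresses :: "planar_ifs \<Rightarrow> nat list set" where
  "addresses I = lists {1..num I}"

definition address_map :: "planar_ifs \<Rightarrow> nat list \<Rightarrow> complex \<Rightarrow> complex" where
  "address_map I a = foldr (ifs_map I) a"

definition address_fixpoint :: "planar_ifs \<Rightarrow> nat list \<Rightarrow> complex" where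
  "address_fixpoint I x = (THE z. address_map I x z = z)"

definition address_value :: "planar_ifs \<Rightarrow> nat list \<Rightarrow> real" where
  "address_value I a = (\<Sum>k\<leftarrow>a. angle I k) rmod (2 * pi)"

definition blow_split :: "planar_ifs \<Rightarrow> nat list \<Rightarrow> nat list \<Rightarrow> nat list \<Rightarrow> bool" where
  "blow_split I a b x \<longleftrightarrow>
     b \<in> addresses I \<and> x \<in> addresses I \<and> prefix (b @ x) a \<and> address_value I x = 0 \<and> x \<noteq> []"

definition blowable :: "planar_ifs \<Rightarrow> nat list \<Rightarrow> bool" where
  "blowable I a \<longleftrightarrow> (\<exists>b x. blow_split I a b x)"

text \<open>
  The shortest prefix \<open>b @ x\<close> determines \<open>b\<close> and \<open>x\<close>: if \<open>b @ x = b' @ y @ x\<close> with both \<open>x\<close> and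
  \<open>y @ x\<close> of value 0 and \<open>y \<noteq> []\<close>, then \<open>y\<close> has value 0 and \<open>b' @ y\<close> is a shorter such prefix.
\<close>

definition blo :: "planar_ifs \<Rightarrow> nat list \<Rightarrow> complex" where
  "blo I a = (THE z. \<exists>b x. blow_split I a b x \<and>
     (\<forall>b' x'. blow_split I a b' x' \<longrightarrow> length (b @ x) \<le> length (b' @ x')) \<and>
     z = address_map I b (address_fixpoint I x))"

definition EFoc :: "planar_ifs \<Rightarrow> nat \<Rightarrow> complex set" where
  "EFoc I L = {blo I a | a. a \<in> addresses I \<and> length a = L \<and> blowable I a}"

definition Ext :: "complex set \<Rightarrow> complex set" where
  "Ext S = {z. z extreme_point_of (convex hull S)}"

definition stops_at :: "planar_ifs \<Rightarrow> nat \<Rightarrow> bool" where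
  "stops_at I L \<longleftrightarrow>
     EFoc I L \<noteq> {} \<and> hutchinson I (EFoc I L) \<subseteq> convex hull (EFoc I L)"

end

theory Submission
  imports Defs
begin

text \<open>
  The idea is that a word \<open>x\<close> of value 0 acts without rotation: \<open>T\<^sub>x\<close> is a homothety, moving every
  point straight towards its fixed point \<open>p\<^sub>x\<close>.  Hence for a point \<open>f\<close> of the fractal \<open>F\<close>, the point
  \<open>T\<^sub>b (T\<^sub>x f)\<close> lies strictly between the points \<open>T\<^sub>b f\<close> and \<open>T\<^sub>b p\<^sub>x\<close> of \<open>F\<close>, unless all three
  coincide.  An extreme point of \<open>F\<close> that has the form \<open>T\<^sub>b (T\<^sub>x f)\<close> is therefore equal to
  \<open>T\<^sub>b p\<^sub>x\<close>, a blow-up (\<open>extreme_point_factor\<close>).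

  Let \<open>N\<close> be the number of values.  The \<open>N + 1\<close> prefixes of a word of length \<open>N\<close> cannot
  have distinct values, and the stretch between two prefixes of equal value has value 0; so every word
  of length \<open>N\<close> is blowable (\<open>long_address_blowable\<close>).  Every point of \<open>F\<close> lies in \<open>T\<^sub>a F\<close> for some
  such word \<open>a\<close>, and so every extreme point of \<open>F\<close> belongs to \<open>EFoc I N\<close>.  By Krein--Milman,
  \<open>EFoc I N\<close>, which is contained in \<open>F\<close>, has the same convex hull as \<open>F\<close>, and the
  procedure stops at \<open>N\<close> at the latest (\<open>stops_at_card_values\<close>), and \<open>N \<le> 2 N\<close>.

  Wherever the procedure stops, the compact convex set \<open>convex hull (EFoc I L)\<close> is mapped into itself
  by all \<open>T\<^sub>k\<close>, and such a set contains \<open>F\<close> (\<open>subinvariant_subset_superinvariant\<close>).  As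
  \<open>EFoc I L \<subseteq> F\<close>, the two sets have the same convex hull, hence the same extreme points
  (\<open>convex_hull_fractal_eq\<close>).
\<close>

section \<open>The maps of the system and their compositions\<close>

lemma ifs_map_diff:
  "ifs_map I k z - ifs_map I k w = rcis (ratio I k) (angle I k) * (z - w)"
  by (simp add: ifs_map_def algebra_simps)

lemma continuous_on_ifs_map: "continuous_on S (ifs_map I k)"
  unfolding ifs_map_def by (intro continuous_intros)

lemma hutchinsonI: "k \<in> {1..num I} \<Longrightarrow> z \<in> S \<Longrightarrow> ifs_map I k z \<in> hutchinson I S"
  unfolding hutchinson_def by blast

lemma hutchinson_mono: "S \<subseteq> S' \<Longrightarrow> hutchinson I S \<subseteq> hutchinson I S'"
  by (auto simp: hutchinson_def)

lemma address_map_simps [simp]: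
  "address_map I [] z = z"
  "address_map I (k # a) z = ifs_map I k (address_map I a z)"
  "address_map I (a @ b) z = address_map I a (address_map I b z)"
  by (simp_all add: address_map_def)

lemma address_map_diff:
  "address_map I a z - address_map I a w =
     rcis (prod_list (map (ratio I) a)) (sum_list (map (angle I) a)) * (z - w)"
  by (induction a) (simp_all add: ifs_map_diff rcis_mult flip: mult.assoc)

lemma convex_hull_hutchinson_subset:
  assumes "hutchinson I E \<subseteq> convex hull E"
  shows "hutchinson I (convex hull E) \<subseteq> convex hull E"
proof -
  have "ifs_map I k ` (convex hull E) \<subseteq> convex hull E" if k: "k \<in> {1..num I}" for k
  proof -
    define \<phi> where "\<phi> = rcis (ratio I k) (angle I k)"
    have eq: "ifs_map I k = (\<lambda>z. (center I k - \<phi> * center I k) + z) \<circ> (*) \<phi>"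
      by (auto simp: fun_eq_iff ifs_map_def \<phi>_def algebra_simps)
    have lin: "linear ((*) \<phi>)"
      by (rule bounded_linear.linear) (rule bounded_linear_mult_right)
    have "ifs_map I k ` (convex hull E) = convex hull (ifs_map I k ` E)"
      unfolding eq image_comp[symmetric] convex_hull_linear_image[OF lin] convex_hull_translation ..
    also have "\<dots> \<subseteq> convex hull E"
      using assms hutchinsonI[OF k] by (intro hull_minimal) auto
    finally show ?thesis .
  qed
  then show ?thesis unfolding hutchinson_def by (rule UN_least)
qed

lemma ratio_product_bounds:
  assumes "is_planar_ifs I" and "a \<in> addresses I"
  shows "0 < prod_list (map (ratio I) a)" and "prod_list (map (ratio I) a) \<le> 1"
    and "a \<noteq> [] \<Longrightarrow> prod_list (map (ratio I) a) < 1"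
proof -
  have ratio: "0 < ratio I k" "ratio I k < 1" if "k \<in> {1..num I}" for k
    using assms(1) that by (auto simp: is_planar_ifs_def)
  have gen: "0 < prod_list (map (ratio I) a) \<and> prod_list (map (ratio I) a) \<le> 1 \<and>
        (a \<noteq> [] \<longrightarrow> prod_list (map (ratio I) a) < 1)" if "set a \<subseteq> {1..num I}"
    using that
  proof (induction a)
    case (Cons k a)
    then have IH: "0 < prod_list (map (ratio I) a)" "prod_list (map (ratio I) a) \<le> 1"
      by auto
    have r: "0 < ratio I k" "ratio I k < 1" using Cons.prems ratio by auto
    have "ratio I k * prod_list (map (ratio I) a) \<le> ratio I k * 1"
      using IH r by (intro mult_left_mono) auto
    then have "ratio I k * prod_list (map (ratio I) a) < 1" using r by linarith
    then show ?case using IH r by simp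
  qed simp
  have "set a \<subseteq> {1..num I}" using assms(2) by (auto simp: addresses_def)
  from gen[OF this]
  show "0 < prod_list (map (ratio I) a)" "prod_list (map (ratio I) a) \<le> 1"
    "a \<noteq> [] \<Longrightarrow> prod_list (map (ratio I) a) < 1" by blast+
qed

text \<open>The affine map with linear part \<open>\<phi> \<noteq> 1\<close> and constant term \<open>c\<close> fixes exactly \<open>c / (1 - \<phi>)\<close>.\<close>

lemma address_fixpoint_fixed:
  assumes "is_planar_ifs I" and "x \<in> addresses I" and "x \<noteq> []"
  shows "address_map I x (address_fixpoint I x) = address_fixpoint I x"
proof -
  define \<phi> where "\<phi> = rcis (prod_list (map (ratio I) x)) (sum_list (map (angle I) x))"
  define c where "c = address_map I x 0"
  have "norm \<phi> < 1"
    using ratio_product_bounds[OF assms(1,2)] assms(3) by (simp add: \<phi>_def)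
  then have ne: "1 - \<phi> \<noteq> 0" by auto
  have eq: "address_map I x z = \<phi> * z + c" for z
    using address_map_diff[of I x z 0] by (simp add: \<phi>_def c_def algebra_simps)
  have "\<exists>!z. address_map I x z = z"
  proof (rule ex1I)
    show "address_map I x (c / (1 - \<phi>)) = c / (1 - \<phi>)"
      unfolding eq using ne by (simp add: field_simps)
    show "z = c / (1 - \<phi>)" if "address_map I x z = z" for z
      using that ne unfolding eq by (simp add: field_simps)
  qed
  then show ?thesis unfolding address_fixpoint_def by (rule theI')
qed

section \<open>The fractal\<close>

text \<open>
  A point of \<open>F\<close> farthest from \<open>G\<close> is the image of a point of \<open>F\<close> under some \<open>T\<^sub>k\<close>; the contraction
  \<open>T\<^sub>k\<close> shrinks the distance to \<open>G\<close>, so that the largest distance must be 0.  Used for the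
  uniqueness of the fractal and for its inclusion in invariant convex hulls.
\<close>

lemma subinvariant_subset_superinvariant:
  assumes "is_planar_ifs I"
    and "compact F" and "F \<subseteq> hutchinson I F"
    and "closed G" and "G \<noteq> {}" and "hutchinson I G \<subseteq> G"
  shows "F \<subseteq> G"
proof (cases "F = {}")
  case False
  have "continuous_on F (\<lambda>z. infdist z G)"
    by (intro continuous_intros)
  then obtain f where f: "f \<in> F" and f_max: "\<And>z. z \<in> F \<Longrightarrow> infdist z G \<le> infdist f G"
    using continuous_attains_sup[OF assms(2) False] by blast
  from f assms(3) obtain k f' where k: "k \<in> {1..num I}" and f': "f' \<in> F" "f = ifs_map I k f'"
    by (auto simp: hutchinson_def)
  obtain g where g: "g \<in> G" "infdist f' G = dist f' g"
    using infdist_attains_inf[OF assms(4,5)] by blast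
  have r: "0 < ratio I k" "ratio I k < 1"
    using assms(1) k by (auto simp: is_planar_ifs_def)
  have "infdist f G \<le> dist f (ifs_map I k g)"
    using assms(6) hutchinsonI[OF k g(1)] by (intro infdist_le) blast
  also have "\<dots> = ratio I k * infdist f' G"
    using r unfolding f'(2) g(2) by (simp add: dist_norm ifs_map_diff norm_mult)
  also have "\<dots> \<le> ratio I k * infdist f G"
    using r f_max[OF f'(1)] by (intro mult_left_mono) auto
  finally have "(1 - ratio I k) * infdist f G \<le> 0" by (simp add: algebra_simps)
  then have "infdist f G \<le> 0" using r by (simp add: mult_le_0_iff)
  then have "infdist z G = 0" if "z \<in> F" for z
    using f_max[OF that] infdist_nonneg[of z G] by linarith
  then show ?thesis
    using in_closed_iff_infdist_zero[OF assms(4,5)] by blast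
qed simp

text \<open>
  Existence: the orbit of the centre of \<open>T\<^sub>1\<close> under all words satisfies \<open>H(S) = S\<close> exactly, because this
  centre is itself an image under \<open>T\<^sub>1\<close>; it is bounded, and its closure is the fractal.
\<close>

lemma ex1_fractal:
  assumes "is_planar_ifs I"
  shows "\<exists>!F. F \<noteq> {} \<and> compact F \<and> hutchinson I F = F"
proof -
  have num: "1 \<in> {1..num I}" using assms by (auto simp: is_planar_ifs_def)
  define c where "c = center I 1"
  define S where "S = (\<lambda>a. address_map I a c) ` addresses I"
  have S_inv: "hutchinson I S = S"
  proof
    show "hutchinson I S \<subseteq> S"
    proof
      fix z assume "z \<in> hutchinson I S"
      then obtain k a where "k \<in> {1..num I}" "a \<in> addresses I" "z = address_map I (k # a) c"
        by (auto simp: hutchinson_def S_def)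
      then show "z \<in> S"
        unfolding S_def by (intro image_eqI[of _ _ "k # a"]) (auto simp: addresses_def)
    qed
    show "S \<subseteq> hutchinson I S"
    proof
      fix z assume "z \<in> S"
      then obtain a where a: "a \<in> addresses I" "z = address_map I a c" by (auto simp: S_def)
      show "z \<in> hutchinson I S"
      proof (cases a)
        case Nil
        then have "z = ifs_map I 1 c" using a by (simp add: ifs_map_def c_def)
        moreover have "c \<in> S"
          unfolding S_def by (rule image_eqI[of _ _ "[]"]) (auto simp: addresses_def)
        ultimately show ?thesis using num by (auto simp: hutchinson_def)
      next
        case (Cons k b)
        then have "k \<in> {1..num I}" "address_map I b c \<in> S"
          using a(1) by (auto simp: S_def addresses_def)
        then show ?thesis using hutchinsonI a(2) Cons by simp
      qed
    qed
  qed

  \<comment> \<open>A ball around \<open>c\<close> is mapped into itself by \<open>T\<^sub>k\<close> if its radius \<open>R\<close> satisfies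
    \<open>ratio I k * R + dist (T\<^sub>k c) c \<le> R\<close>; the sum over all indices serves every \<open>k\<close> at once.\<close>
  define d where "d = (\<lambda>k. norm (ifs_map I k c - c) / (1 - ratio I k))"
  define R where "R = (\<Sum>k\<in>{1..num I}. d k)"
  have r: "0 < ratio I k" "ratio I k < 1" if "k \<in> {1..num I}" for k
    using assms that by (auto simp: is_planar_ifs_def)
  have d_nonneg: "0 \<le> d k" if "k \<in> {1..num I}" for k
    using r[OF that] by (simp add: d_def)
  have "norm (address_map I a c - c) \<le> R" if "set a \<subseteq> {1..num I}" for a
    using that
  proof (induction a)
    case Nil
    then show ?case by (auto simp: R_def intro!: sum_nonneg d_nonneg)
  next
    case (Cons k a)
    then have k: "k \<in> {1..num I}" by auto
    have "d k \<le> R" unfolding R_def using k d_nonneg by (intro member_le_sum) auto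
    then have dk: "norm (ifs_map I k c - c) \<le> (1 - ratio I k) * R"
      using r[OF k] by (simp add: d_def field_simps)
    have "norm (ifs_map I k (address_map I a c) - c)
        \<le> norm (ifs_map I k (address_map I a c) - ifs_map I k c) + norm (ifs_map I k c - c)"
      using norm_triangle_ineq by (metis diff_add_cancel add_diff_eq)
    also have "\<dots> \<le> ratio I k * R + (1 - ratio I k) * R"
      using Cons r[OF k] dk
      by (intro add_mono) (auto simp: ifs_map_diff norm_mult intro!: mult_left_mono)
    finally show ?case by (simp add: algebra_simps)
  qed
  then have "dist (address_map I a c) c \<le> R" if "a \<in> addresses I" for a
    using that by (simp only: dist_norm addresses_def lists_eq_set mem_Collect_eq)
  then have "S \<subseteq> cball c R" unfolding S_def by (auto simp: dist_commute)
  then have "bounded S" using bounded_subset bounded_cball by blast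
  then have comp: "compact (closure S)" by simp
  have ne: "closure S \<noteq> {}" by (auto simp: S_def addresses_def)
  have inv: "hutchinson I (closure S) = closure S"
  proof
    have "ifs_map I k ` closure S \<subseteq> closure S" if "k \<in> {1..num I}" for k
    proof (rule image_closure_subset[OF continuous_on_ifs_map closed_closure])
      have "ifs_map I k ` S \<subseteq> S" using hutchinsonI[OF that, of _ S] S_inv by auto
      then show "ifs_map I k ` S \<subseteq> closure S" using closure_subset[of S] by (rule subset_trans)
    qed
    then show "hutchinson I (closure S) \<subseteq> closure S" unfolding hutchinson_def by (rule UN_least)
    have "compact (hutchinson I (closure S))"
      unfolding hutchinson_def
      by (intro compact_UN compact_continuous_image continuous_on_ifs_map comp) auto
    moreover have "S \<subseteq> hutchinson I (closure S)"
      using S_inv hutchinson_mono[OF closure_subset] by blast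
    ultimately show "closure S \<subseteq> hutchinson I (closure S)"
      by (intro closure_minimal compact_imp_closed)
  qed
  show ?thesis
  proof (rule ex1I)
    show "closure S \<noteq> {} \<and> compact (closure S) \<and> hutchinson I (closure S) = closure S"
      using ne comp inv by blast
    fix F assume F: "F \<noteq> {} \<and> compact F \<and> hutchinson I F = F"
    show "F = closure S"
      using subinvariant_subset_superinvariant[OF assms, of F "closure S"]
        subinvariant_subset_superinvariant[OF assms, of "closure S" F] F comp ne inv
      by (auto dest: compact_imp_closed)
  qed
qed

lemma ifs_fractal_props:
  assumes "is_planar_ifs I"
  shows "ifs_fractal I \<noteq> {}" and "compact (ifs_fractal I)"
    and "hutchinson I (ifs_fractal I) = ifs_fractal I"
  using theI'[OF ex1_fractal[OF assms]] unfolding ifs_fractal_def by blast+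

lemma address_map_in_fractal:
  assumes "is_planar_ifs I" and "a \<in> addresses I" and "z \<in> ifs_fractal I"
  shows "address_map I a z \<in> ifs_fractal I"
proof -
  have "set a \<subseteq> {1..num I}" using assms(2) by (auto simp: addresses_def)
  then show ?thesis
  proof (induction a)
    case (Cons k a)
    then have "ifs_map I k (address_map I a z) \<in> hutchinson I (ifs_fractal I)"
      by (auto simp: hutchinson_def)
    then show ?case using ifs_fractal_props(3)[OF assms(1)] by simp
  qed (simp add: assms(3))
qed

lemma fractal_point_address:
  assumes "is_planar_ifs I" and "z \<in> ifs_fractal I"
  obtains a f where "a \<in> addresses I" "length a = n" "f \<in> ifs_fractal I" "z = address_map I a f"
proof -
  have "\<exists>a f. a \<in> addresses I \<and> length a = n \<and> f \<in> ifs_fractal I \<and> z = address_map I a f"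
    using assms(2)
  proof (induction n arbitrary: z)
    case 0
    then show ?case by (intro exI[of _ "[]"] exI[of _ z]) (auto simp: addresses_def)
  next
    case (Suc n)
    then have "z \<in> hutchinson I (ifs_fractal I)"
      using ifs_fractal_props(3)[OF assms(1)] by simp
    then obtain k y where k: "k \<in> {1..num I}" "y \<in> ifs_fractal I" "z = ifs_map I k y"
      by (auto simp: hutchinson_def)
    from Suc.IH[OF k(2)] obtain a f where
      "a \<in> addresses I" "length a = n" "f \<in> ifs_fractal I" "y = address_map I a f" by blast
    then show ?case
      using k by (intro exI[of _ "k # a"] exI[of _ f]) (auto simp: addresses_def)
  qed
  then show ?thesis using that by blast
qed

text \<open>\<open>T\<^sub>x\<close> moves the point of \<open>F\<close> nearest to \<open>p\<^sub>x\<close> still nearer, within \<open>F\<close>, unless it is \<open>p\<^sub>x\<close>.\<close>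

lemma address_fixpoint_in_fractal:
  assumes "is_planar_ifs I" and "x \<in> addresses I" and "x \<noteq> []"
  shows "address_fixpoint I x \<in> ifs_fractal I"
proof -
  let ?p = "address_fixpoint I x"
  let ?r = "prod_list (map (ratio I) x)"
  have r: "0 < ?r" "?r < 1" using ratio_product_bounds[OF assms(1,2)] assms(3) by auto
  obtain q where q: "q \<in> ifs_fractal I" "\<And>y. y \<in> ifs_fractal I \<Longrightarrow> dist ?p q \<le> dist ?p y"
    using distance_attains_inf[of "ifs_fractal I" ?p] ifs_fractal_props[OF assms(1)]
    by (metis compact_imp_closed)
  have "dist ?p q \<le> dist ?p (address_map I x q)"
    by (intro q(2) address_map_in_fractal assms q(1))
  also have "\<dots> = dist (address_map I x ?p) (address_map I x q)"
    by (simp add: address_fixpoint_fixed[OF assms])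
  also have "\<dots> = ?r * dist ?p q"
    using r by (simp add: dist_norm address_map_diff norm_mult)
  finally have "(1 - ?r) * dist ?p q \<le> 0" by (simp add: algebra_simps)
  then have "?p = q" using r by (simp add: mult_le_0_iff)
  then show ?thesis using q(1) by simp
qed

section \<open>Values of addresses and blow-ups\<close>

lemma cis_address_value: "cis (address_value I a) = cis (sum_list (map (angle I) a))"
  by (simp add: address_value_def)

lemma address_value_eq_iff:
  "address_value I a = address_value I b \<longleftrightarrow>
     cis (sum_list (map (angle I) a)) = cis (sum_list (map (angle I) b))"
  by (simp add: cis_eq_iff rcong_def address_value_def)

lemma address_value_eq_0_iff:
  "address_value I a = 0 \<longleftrightarrow> cis (sum_list (map (angle I) a)) = 1"
  using address_value_eq_iff[of I a "[]"] by (simp add: address_value_def)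

lemma address_value_append_left:
  "address_value I (a @ b) = address_value I a \<longleftrightarrow> address_value I b = 0"
  by (simp add: address_value_eq_iff address_value_eq_0_iff flip: cis_mult)

lemma address_value_append_right:
  "address_value I (a @ b) = address_value I b \<longleftrightarrow> address_value I a = 0"
  by (simp add: address_value_eq_iff address_value_eq_0_iff flip: cis_mult)

text \<open>
  If the angles, measured in full turns, have the common denominator \<open>D\<close>, then \<open>cis\<close> maps the values
  injectively to \<open>D\<close>-th roots of unity.
\<close>

lemma finite_address_values:
  assumes "of_unity I"
  shows "finite (address_value I ` addresses I)"
proof -
  have "\<exists>n::nat. n > 0 \<and> cis (angle I k) ^ n = 1" if k: "k \<in> {1..num I}" for k
  proof -
    have "angle I k / (2 * pi) \<in> \<rat>" using assms k by (auto simp: of_unity_def)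
    then obtain m n :: int where mn: "n > 0" "angle I k / (2 * pi) = of_int m / of_int n"
      by (auto elim: Rats_cases')
    have "real (nat n) * angle I k = of_int m * (2 * pi)"
      using mn by (simp add: field_simps)
    then have "cis (angle I k) ^ nat n = 1"
      unfolding Complex.DeMoivre cis_eq_1_iff by blast
    then show ?thesis using mn(1) by (intro exI[of _ "nat n"]) auto
  qed
  then obtain e :: "nat \<Rightarrow> nat" where e:
    "\<And>k. k \<in> {1..num I} \<Longrightarrow> e k > 0" "\<And>k. k \<in> {1..num I} \<Longrightarrow> cis (angle I k) ^ e k = 1"
    by metis
  define D where "D = (\<Prod>k\<in>{1..num I}. e k)"
  have "D > 0" unfolding D_def using e(1) by (intro prod_pos) auto
  have D: "cis (angle I k) ^ D = 1" if "k \<in> {1..num I}" for k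
  proof -
    have "e k dvd D" unfolding D_def using that by (intro dvd_prodI) auto
    then obtain j where "D = e k * j" by (auto elim: dvdE)
    then show ?thesis using e(2)[OF that] by (simp add: power_mult)
  qed
  have root: "cis (address_value I a) ^ D = 1" if "a \<in> addresses I" for a
  proof -
    have "set a \<subseteq> {1..num I}" using that by (auto simp: addresses_def)
    then have "cis (sum_list (map (angle I) a)) ^ D = 1"
      by (induction a) (simp_all add: D power_mult_distrib flip: cis_mult)
    then show ?thesis by (simp add: cis_address_value)
  qed
  have "cis ` address_value I ` addresses I \<subseteq> {z. z ^ D = 1}" using root by auto
  moreover have "finite {z::complex. z ^ D = 1}"
    using \<open>D > 0\<close> by (intro finite_roots_unity) auto
  ultimately have "finite (cis ` address_value I ` addresses I)" by (rule finite_subset)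
  moreover have "inj_on cis (address_value I ` addresses I)"
    by (auto simp: inj_on_def cis_address_value address_value_eq_iff)
  ultimately show ?thesis by (rule finite_imageD)
qed

text \<open>
  The description in \<open>blo\<close> is proper: two shortest splits of one word have equal concatenations, and
  if their cuts differed, the stretch between the two cuts would have value 0 and yield a
  shorter split.
\<close>

lemma blo_split:
  assumes "blowable I a"
  obtains b x where "blow_split I a b x" "blo I a = address_map I b (address_fixpoint I x)"
proof -
  define shortest where "shortest = (\<lambda>b x. blow_split I a b x \<and>
      (\<forall>b' x'. blow_split I a b' x' \<longrightarrow> length (b @ x) \<le> length (b' @ x')))"
  define P where "P = (\<lambda>n. \<exists>b x. blow_split I a b x \<and> length (b @ x) = n)"
  have "\<exists>n. P n" using assms by (auto simp: P_def blowable_def)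
  then have "P (LEAST n. P n)" by (rule LeastI_ex)
  then obtain b x where bx: "blow_split I a b x" "length (b @ x) = (LEAST n. P n)"
    unfolding P_def by blast
  have "(LEAST n. P n) \<le> length (b' @ x')" if "blow_split I a b' x'" for b' x'
    by (rule Least_le) (use that in \<open>auto simp: P_def\<close>)
  then have s: "shortest b x" using bx by (simp add: shortest_def)
  have cut: False
    if s1: "shortest b1 x1" and b2: "b2 = b1 @ y" and s2: "shortest b2 x2" and x1: "x1 = y @ x2"
      and y: "y \<noteq> []" for b1 x1 b2 x2 y
  proof -
    have sp1: "blow_split I a b1 x1" and sp2: "blow_split I a b2 x2"
      using s1 s2 by (auto simp: shortest_def)
    have "address_value I y = 0"
      using sp1 sp2 x1 address_value_append_right[of I y x2] by (auto simp: blow_split_def)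
    moreover have "prefix (b1 @ y) a"
      using sp2 b2 by (auto simp: blow_split_def prefix_def)
    ultimately have "blow_split I a b1 y"
      using sp1 x1 y by (auto simp: blow_split_def addresses_def)
    then have "length (b1 @ x1) \<le> length (b1 @ y)" using s1 unfolding shortest_def by blast
    then show False using x1 sp2 by (auto simp: blow_split_def)
  qed
  have uniq: "b' = b \<and> x' = x" if s': "shortest b' x'" for b' x'
  proof -
    have "length (b @ x) = length (b' @ x')"
      using s s' by (intro antisym) (auto simp: shortest_def)
    moreover have "prefix (b @ x) a" "prefix (b' @ x') a"
      using s s' by (auto simp: shortest_def blow_split_def)
    ultimately have "b @ x = b' @ x'" by (metis prefix_order.antisym prefix_length_prefix order_refl)
    then obtain y where "b = b' @ y \<and> y @ x = x' \<or> b @ y = b' \<and> x = y @ x'"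
      by (auto simp: append_eq_append_conv2)
    then show ?thesis using cut[OF s' _ s, of y] cut[OF s _ s', of y] by (cases "y = []") auto
  qed
  have "blo I a = address_map I b (address_fixpoint I x)"
    unfolding blo_def conj_assoc[symmetric]
  proof (rule the_equality)
    show "\<exists>b' x'. (blow_split I a b' x' \<and>
       (\<forall>b'' x''. blow_split I a b'' x'' \<longrightarrow> length (b' @ x') \<le> length (b'' @ x''))) \<and>
       address_map I b (address_fixpoint I x) = address_map I b' (address_fixpoint I x')"
      using s unfolding shortest_def by blast
  qed (use uniq in \<open>unfold shortest_def, blast\<close>)
  then show ?thesis using that bx(1) by blast
qed

lemma EFoc_subset_fractal:
  assumes "is_planar_ifs I"
  shows "EFoc I L \<subseteq> ifs_fractal I"
proof
  fix z assume "z \<in> EFoc I L"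
  then obtain a where a: "z = blo I a" "blowable I a" by (auto simp: EFoc_def)
  obtain b x where bx: "blow_split I a b x" "z = address_map I b (address_fixpoint I x)"
    using blo_split[OF a(2)] a(1) by metis
  then have "b \<in> addresses I" "x \<in> addresses I" "x \<noteq> []" by (auto simp: blow_split_def)
  then show "z \<in> ifs_fractal I"
    unfolding bx(2) using assms
    by (intro address_map_in_fractal address_fixpoint_in_fractal)
qed

lemma finite_EFoc: "finite (EFoc I L)"
proof -
  have "EFoc I L \<subseteq> blo I ` {a. set a \<subseteq> {1..num I} \<and> length a = L}"
    by (auto simp: EFoc_def addresses_def)
  then show ?thesis by (rule finite_subset) (intro finite_imageI finite_lists_length_eq, simp)
qed

text \<open>Pigeonhole on the values of the \<open>length a + 1\<close> prefixes of \<open>a\<close>.\<close>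

lemma long_address_blowable:
  assumes "of_unity I" and "a \<in> addresses I"
    and "card (address_value I ` addresses I) \<le> length a"
  shows "blowable I a"
proof -
  define v where "v = (\<lambda>i. address_value I (take i a))"
  have take: "take i a \<in> addresses I" for i
    using assms(2) by (auto simp: addresses_def dest: in_set_takeD)
  have "v ` {0..length a} \<subseteq> address_value I ` addresses I"
    using take by (auto simp: v_def)
  then have "card (v ` {0..length a}) \<le> card (address_value I ` addresses I)"
    by (intro card_mono finite_address_values assms(1))
  then have "card (v ` {0..length a}) < card {0..length a}" using assms(3) by simp
  then have "\<not> inj_on v {0..length a}" by (rule pigeonhole)
  then obtain i j where ij: "i < j" "j \<le> length a" "v i = v j"
    unfolding inj_on_def by (metis atLeastAtMost_iff linorder_neqE_nat)
  define x where "x = drop i (take j a)"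
  have eq: "take i a @ x = take j a"
    using ij by (metis x_def append_take_drop_id min.absorb1 less_imp_le take_take)
  have "address_value I x = 0"
    using ij(3) address_value_append_left[of I "take i a" x] eq by (simp add: v_def)
  moreover have "x \<noteq> []" using ij by (simp add: x_def)
  moreover have "x \<in> addresses I"
    using take[of j] by (auto simp: x_def addresses_def dest: in_set_dropD)
  ultimately have "blow_split I a (take i a) x"
    using take eq by (simp add: blow_split_def take_is_prefix)
  then show ?thesis by (auto simp: blowable_def)
qed

section \<open>Extreme points\<close>

lemma Ext_subset: "Ext S \<subseteq> S"
  by (auto simp: Ext_def intro: extreme_point_of_convex_hull)

text \<open>
  As \<open>T\<^sub>x\<close> has a positive real linear part \<open>r < 1\<close>, the point \<open>T\<^sub>b (T\<^sub>x f)\<close> is the convex combination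
  of \<open>T\<^sub>b f\<close> and \<open>T\<^sub>b p\<^sub>x\<close> with weights \<open>r\<close> and \<open>1 - r\<close>.
\<close>

lemma extreme_point_factor:
  assumes "is_planar_ifs I"
    and "b \<in> addresses I" and "x \<in> addresses I" and "x \<noteq> []" and "address_value I x = 0"
    and "f \<in> ifs_fractal I"
    and "address_map I b (address_map I x f) \<in> Ext (ifs_fractal I)"
  shows "address_map I b (address_map I x f) = address_map I b (address_fixpoint I x)"
proof -
  let ?p = "address_fixpoint I x"
  let ?e = "address_map I b (address_map I x f)"
  let ?u = "address_map I b f" and ?v = "address_map I b ?p"
  let ?r = "prod_list (map (ratio I) x)"
  let ?\<phi> = "rcis (prod_list (map (ratio I) b)) (sum_list (map (angle I) b))"
  have r: "0 < ?r" "?r < 1" using ratio_product_bounds[OF assms(1,3)] assms(4) by auto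
  have "rcis ?r (sum_list (map (angle I) x)) = of_real ?r"
    using assms(5) by (simp add: rcis_def address_value_eq_0_iff)
  then have x: "address_map I x f - ?p = of_real ?r * (f - ?p)"
    using address_map_diff[of I x f ?p] address_fixpoint_fixed[OF assms(1,3,4)] by simp
  have "?e - ?v = ?\<phi> * (of_real ?r * (f - ?p))"
    unfolding address_map_diff x ..
  also have "\<dots> = of_real ?r * (?u - ?v)" unfolding address_map_diff by simp
  finally have e: "?e = (1 - ?r) *\<^sub>R ?v + ?r *\<^sub>R ?u"
    by (simp add: scaleR_conv_of_real algebra_simps)
  have "?u \<in> convex hull (ifs_fractal I)" "?v \<in> convex hull (ifs_fractal I)"
    using assms by (auto intro!: hull_inc address_map_in_fractal address_fixpoint_in_fractal)
  then have "?e \<notin> open_segment ?v ?u"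
    using assms(7) by (auto simp: Ext_def extreme_point_of_def)
  then have "?v = ?u" using e r by (auto simp: in_segment)
  then show ?thesis using e by (simp add: scaleR_add_left[symmetric])
qed

lemma Ext_fractal_subset_EFoc:
  assumes "is_planar_ifs I" and "of_unity I"
    and "card (address_value I ` addresses I) \<le> L"
  shows "Ext (ifs_fractal I) \<subseteq> EFoc I L"
proof
  fix e assume e: "e \<in> Ext (ifs_fractal I)"
  then have "e \<in> ifs_fractal I" using Ext_subset by blast
  then obtain a g where a: "a \<in> addresses I" "length a = L" "g \<in> ifs_fractal I"
    and e_eq: "e = address_map I a g"
    using fractal_point_address[OF assms(1)] by blast
  have blowable: "blowable I a" using a assms(2,3) by (intro long_address_blowable) auto
  then obtain b x where bx: "blow_split I a b x"
    and blo: "blo I a = address_map I b (address_fixpoint I x)"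
    by (rule blo_split)
  then have b: "b \<in> addresses I" and x: "x \<in> addresses I" "x \<noteq> []" "address_value I x = 0"
    by (auto simp: blow_split_def)
  from bx obtain c where c: "a = b @ x @ c" by (auto simp: blow_split_def prefix_def)
  then have "c \<in> addresses I" using a(1) by (auto simp: addresses_def)
  then have "address_map I c g \<in> ifs_fractal I" using assms(1) a(3) by (intro address_map_in_fractal)
  then have "e = blo I a"
    using extreme_point_factor[OF assms(1) b x, of "address_map I c g"] e
    unfolding blo by (simp add: e_eq c)
  then show "e \<in> EFoc I L" using a blowable by (auto simp: EFoc_def)
qed

lemma stops_at_card_values:
  assumes "is_planar_ifs I" and "of_unity I"
  shows "stops_at I (card (address_value I ` addresses I))"
proof -
  let ?F = "ifs_fractal I" and ?E = "EFoc I (card (address_value I ` addresses I))"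
  have "compact (convex hull ?F)"
    using ifs_fractal_props(2)[OF assms(1)] by (rule compact_convex_hull)
  then have "convex hull ?F = convex hull (Ext ?F)"
    unfolding Ext_def by (rule Krein_Milman_Minkowski) (rule convex_convex_hull)
  also have "\<dots> \<subseteq> convex hull ?E"
    using Ext_fractal_subset_EFoc[OF assms order_refl] by (rule hull_mono)
  finally have hull: "convex hull ?F \<subseteq> convex hull ?E" .
  have "hutchinson I ?E \<subseteq> hutchinson I ?F"
    by (intro hutchinson_mono EFoc_subset_fractal assms(1))
  also have "\<dots> = ?F" by (rule ifs_fractal_props(3)[OF assms(1)])
  also have "\<dots> \<subseteq> convex hull ?F" by (rule hull_subset)
  also have "\<dots> \<subseteq> convex hull ?E" by (rule hull)
  finally have "hutchinson I ?E \<subseteq> convex hull ?E" .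
  moreover have "?E \<noteq> {}"
    using hull ifs_fractal_props(1)[OF assms(1)] by auto
  ultimately show ?thesis by (simp add: stops_at_def)
qed

lemma convex_hull_fractal_eq:
  assumes "is_planar_ifs I" and "stops_at I L"
  shows "convex hull (ifs_fractal I) = convex hull (EFoc I L)"
proof
  show "convex hull (EFoc I L) \<subseteq> convex hull (ifs_fractal I)"
    by (intro hull_mono EFoc_subset_fractal assms(1))
  have "ifs_fractal I \<subseteq> convex hull (EFoc I L)"
  proof (rule subinvariant_subset_superinvariant[OF assms(1) ifs_fractal_props(2)[OF assms(1)]])
    show "ifs_fractal I \<subseteq> hutchinson I (ifs_fractal I)"
      by (simp add: ifs_fractal_props(3)[OF assms(1)])
    show "closed (convex hull (EFoc I L))"
      by (intro compact_imp_closed compact_convex_hull finite_imp_compact finite_EFoc)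
    show "convex hull (EFoc I L) \<noteq> {}"
      using assms(2) by (simp add: stops_at_def)
    show "hutchinson I (convex hull (EFoc I L)) \<subseteq> convex hull (EFoc I L)"
      using assms(2) by (intro convex_hull_hutchinson_subset) (simp add: stops_at_def)
  qed
  then show "convex hull (ifs_fractal I) \<subseteq> convex hull (EFoc I L)"
    by (rule hull_minimal) (rule convex_convex_hull)
qed

theorem mainTheorem4:
  fixes I :: planar_ifs
  assumes "is_planar_ifs I" and "of_unity I"
  shows "\<exists>Ls\<ge>1. stops_at I Ls \<and> (\<forall>L. 1 \<le> L \<and> L < Ls \<longrightarrow> \<not> stops_at I L) \<and>
           Ls \<le> 2 * card (address_value I ` addresses I) \<and>
           Ext (ifs_fractal I) = Ext (EFoc I Ls)"
proof -
  define N where "N = card (address_value I ` addresses I)"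
  define Ls where "Ls = (LEAST L. 1 \<le> L \<and> stops_at I L)"
  have "address_value I ` addresses I \<noteq> {}" by (auto simp: addresses_def)
  then have "1 \<le> N"
    using finite_address_values[OF assms(2)] by (simp add: N_def Suc_le_eq card_gt_0_iff)
  then have N: "1 \<le> N \<and> stops_at I N" using stops_at_card_values[OF assms] by (simp add: N_def)
  have Ls: "1 \<le> Ls \<and> stops_at I Ls" unfolding Ls_def using N by (rule LeastI)
  have "Ls \<le> N" unfolding Ls_def using N by (rule Least_le)
  moreover have "\<not> stops_at I L" if "1 \<le> L" "L < Ls" for L
    using not_less_Least[of L] that unfolding Ls_def by blast
  moreover have "Ext (ifs_fractal I) = Ext (EFoc I Ls)"
    unfolding Ext_def using convex_hull_fractal_eq[OF assms(1), of Ls] Ls by simp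
  ultimately show ?thesis using Ls by (intro exI[of _ Ls]) (auto simp: N_def)
qed

end
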